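(* Let $\theta\colon\mathbb{Z}\to\mathbb{Z}$ be an arbitrary non-annihilating homomorphism of the additive group of integers. Suppose that $\mathbf{B}(\mathbb{Z},\theta)$ is a dense subsemigroup, discrete in the subspace topology, of a Hausdorff semitopological monoid $S$, and that $I=S\setminus\mathbf{B}(\mathbb{Z},\theta)\neq\varnothing$. Then $I$ is a two-sided ideal of $S$.
   Context: $\mathbb{N}_0$ is the set of non-negative integers. A semitopological monoid is a monoid with a topology for which multiplication is separately continuous. A homomorphism $\theta$ is annihilating if $\theta(z)=0$ for all $z$; non-annihilating otherwise. The Reilly semigroup $\mathbf{B}(\mathbb{Z},\theta)$ is the set $\mathbb{N}_0\times\mathbb{Z}\times\mathbb{N}_0$ with $$(i,s,j)\cdot(m,t,n)=\left(i+m-\min\{j,m\},\ \theta^{m-\min\{j,m\}}(s)+\theta^{j-\min\{j,m\}}(t),\ j+n-\min\{j,m\}\right),$$ where $\theta^0$ is the identity map and $\theta^k$ is the $k$-fold iterate. *)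

theory Defs
  imports "HOL-Analysis.Analysis" "HOL-Algebra.Elementary_Groups"
begin

definition reilly_mult ::
  "(int \<Rightarrow> int) \<Rightarrow> nat \<times> int \<times> nat \<Rightarrow> nat \<times> int \<times> nat \<Rightarrow> nat \<times> int \<times> nat"
where
  "reilly_mult \<theta> = (\<lambda>(i, s, j) (m, t, n).
     (i + m - min j m,
      (\<theta> ^^ (m - min j m)) s + (\<theta> ^^ (j - min j m)) t,
      j + n - min j m))"

definition reilly :: "(int \<Rightarrow> int) \<Rightarrow> (nat \<times> int \<times> nat) monoid" where
  "reilly \<theta> = \<lparr>carrier = UNIV, monoid.mult = reilly_mult \<theta>, one = (0, 0, 0)\<rparr>"

definition annihilating :: "(int \<Rightarrow> int) \<Rightarrow> bool" where
  "annihilating \<theta> \<longleftrightarrow> (\<forall>z. \<theta> z = 0)"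

locale semitopological_monoid = monoid S
  for S :: "('a, 'b) monoid_scheme" (structure) and T :: "'a topology" +
  assumes topspace_eq: "topspace T = carrier S"
    and continuous_left: "a \<in> carrier S \<Longrightarrow> continuous_map T T (\<lambda>x. a \<otimes> x)"
    and continuous_right: "a \<in> carrier S \<Longrightarrow> continuous_map T T (\<lambda>x. x \<otimes> a)"

text \<open>Ideals in the sense of semigroup theory; the library's \<open>ideal\<close> is the ring-theoretic notion.\<close>

definition two_sided_semigroup_ideal :: "'a set \<Rightarrow> ('a, 'b) monoid_scheme \<Rightarrow> bool" where
  "two_sided_semigroup_ideal I S \<longleftrightarrow>
     I \<noteq> {} \<and> I \<subseteq> carrier S \<and>
     (\<forall>a \<in> carrier S. \<forall>x \<in> I. a \<otimes>\<^bsub>S\<^esub> x \<in> I \<and> x \<otimes>\<^bsub>S\<^esub> a \<in> I)"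

end

theory Submission
  imports Defs
begin

text \<open>
  Two facts carry the proof.

  The topological one: a dense discrete subspace \<open>B\<close> of a Hausdorff space consists of isolated points
  of the whole space, while every neighbourhood of a point \<open>x\<close> outside \<open>B\<close> meets \<open>B\<close> in an infinite
  set. Hence a continuous self-map that sends \<open>x\<close> to a point \<open>b \<in> B\<close> is constantly \<open>b\<close> near \<open>x\<close>, and
  so it takes the value \<open>b\<close> infinitely often on \<open>B\<close> (\<open>infinite_fibre_over_dense_discrete\<close>).

  The algebraic one: a non-annihilating endomorphism of \<open>\<int>\<close> is injective, and for injective \<open>\<theta>\<close> each
  of the equations \<open>a \<cdot> y = b\<close> and \<open>y \<cdot> a = b\<close> has only finitely many solutions \<open>y\<close> in the Reilly
  semigroup (\<open>finite_reilly_left_quotient\<close>, \<open>finite_reilly_right_quotient\<close>).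

  Applied to the translations by \<open>a \<in> B\<close>, these facts contradict each other unless \<open>a\<close> times a point
  of \<open>I\<close>, on either side, stays in \<open>I\<close>. If instead \<open>a\<close> and \<open>x\<close> both lie in \<open>I\<close> and \<open>a \<cdot> x = b \<in> B\<close>,
  the topological fact yields some \<open>y \<in> B\<close> with \<open>a \<cdot> y = b\<close>, which is the case already excluded.
\<close>

section \<open>Dense discrete subspaces\<close>

text \<open>Discreteness isolates \<open>b\<close> only among the points of \<open>B\<close>; density propagates this to the whole
  space, since what is left of a separating neighbourhood after removing \<open>b\<close> is open and misses
  \<open>B\<close>.\<close>

lemma openin_singleton_of_dense_discrete:
  assumes "t1_space T" and dense: "T closure_of B = topspace T"
    and discrete: "subtopology T B = discrete_topology B" and "b \<in> B"
  shows "openin T {b}"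
proof -
  have "openin (subtopology T B) {b}"
    using discrete \<open>b \<in> B\<close> by simp
  then obtain U where U: "openin T U" "{b} = U \<inter> B"
    by (auto simp: openin_subtopology)
  then have "openin T (U - {b})"
    using \<open>t1_space T\<close> by (metis closedin_t1_singleton insertI1 IntD1 openin_diff openin_subset subsetD)
  moreover have "(U - {b}) \<inter> B = {}"
    using U by blast
  ultimately have "U - {b} = {}"
    using dense unfolding dense_intersects_open by blast
  then have "U = {b}"
    using U by blast
  with U(1) show ?thesis by simp
qed

lemma infinite_dense_neighbourhood:
  assumes "t1_space T" and dense: "T closure_of B = topspace T"
    and "openin T U" and "x \<in> U" and "x \<notin> B"
  shows "infinite (U \<inter> B)"
proof
  assume "finite (U \<inter> B)"
  moreover have "U \<inter> B \<subseteq> topspace T"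
    using \<open>openin T U\<close> openin_subset by blast
  ultimately have "closedin T (U \<inter> B)"
    using \<open>t1_space T\<close> by (simp add: t1_space_closedin_finite)
  then have "openin T (U - U \<inter> B)"
    using \<open>openin T U\<close> by (rule openin_diff[rotated])
  moreover have "(U - U \<inter> B) \<inter> B = {}" and "x \<in> U - U \<inter> B"
    using \<open>x \<in> U\<close> \<open>x \<notin> B\<close> by auto
  ultimately show False
    using dense unfolding dense_intersects_open by blast
qed

text \<open>The preimage of the isolated point \<open>f x\<close> is a neighbourhood of \<open>x\<close>, so \<open>B\<close> accumulates there.\<close>

lemma infinite_fibre_over_dense_discrete:
  assumes "t1_space T" and "T closure_of B = topspace T"
    and "subtopology T B = discrete_topology B"
    and "continuous_map T T f" and "x \<in> topspace T" and "x \<notin> B" and "f x \<in> B"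
  shows "infinite {y \<in> B. f y = f x}"
proof -
  define U where "U = {y \<in> topspace T. f y \<in> {f x}}"
  have "openin T U"
    unfolding U_def using assms
    by (intro openin_continuous_map_preimage openin_singleton_of_dense_discrete)
  moreover have "x \<in> U"
    using assms by (simp add: U_def)
  ultimately have "infinite (U \<inter> B)"
    using assms by (intro infinite_dense_neighbourhood)
  then show ?thesis
    by (rule contrapos_nn) (auto simp: U_def elim: rev_finite_subset)
qed

section \<open>Remainders of subsets with finite translation fibres\<close>

text \<open>Only translations by elements of \<open>B\<close> have finite fibres by hypothesis, so products with a factor
  in \<open>B\<close> come first; density then reduces products within the remainder to them.\<close>

lemma (in semitopological_monoid) ideal_of_finite_translation_fibres:
  assumes "t1_space T" and "B \<subseteq> carrier S" and "T closure_of B = topspace T"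
    and "subtopology T B = discrete_topology B" and "carrier S - B \<noteq> {}"
    and fin_left: "\<And>a b. a \<in> B \<Longrightarrow> b \<in> B \<Longrightarrow> finite {y \<in> B. a \<otimes> y = b}"
    and fin_right: "\<And>a b. a \<in> B \<Longrightarrow> b \<in> B \<Longrightarrow> finite {y \<in> B. y \<otimes> a = b}"
  shows "two_sided_semigroup_ideal (carrier S - B) S"
proof -
  have fibre_left: "infinite {y \<in> B. a \<otimes> y = a \<otimes> x}"
    if "a \<in> carrier S" "x \<in> carrier S - B" "a \<otimes> x \<in> B" for a x
    using infinite_fibre_over_dense_discrete[OF assms(1,3,4) continuous_left] that topspace_eq
    by auto
  have fibre_right: "infinite {y \<in> B. y \<otimes> a = x \<otimes> a}"
    if "a \<in> carrier S" "x \<in> carrier S - B" "x \<otimes> a \<in> B" for a x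
    using infinite_fibre_over_dense_discrete[OF assms(1,3,4) continuous_right] that topspace_eq
    by auto
  have left: "a \<otimes> x \<notin> B" if "a \<in> B" "x \<in> carrier S - B" for a x
    using fibre_left[OF _ that(2)] fin_left[OF that(1)] that(1) \<open>B \<subseteq> carrier S\<close> by (meson subsetD)
  have right: "x \<otimes> a \<notin> B" if "a \<in> B" "x \<in> carrier S - B" for a x
    using fibre_right[OF _ that(2)] fin_right[OF that(1)] that(1) \<open>B \<subseteq> carrier S\<close> by (meson subsetD)
  have both: "a \<otimes> x \<notin> B" if "a \<in> carrier S - B" "x \<in> carrier S - B" for a x
  proof
    assume "a \<otimes> x \<in> B"
    then have "{y \<in> B. a \<otimes> y = a \<otimes> x} \<noteq> {}"
      using fibre_left[of a x] that by (metis DiffD1 finite.emptyI)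
    then obtain y where "y \<in> B" "a \<otimes> y \<in> B"
      using \<open>a \<otimes> x \<in> B\<close> by auto
    then show False
      using right[of y a] that by blast
  qed
  show ?thesis
    unfolding two_sided_semigroup_ideal_def
  proof (intro conjI ballI)
    fix a x
    assume a: "a \<in> carrier S" and x: "x \<in> carrier S - B"
    show "a \<otimes> x \<in> carrier S - B" and "x \<otimes> a \<in> carrier S - B"
      using a x left[of a x] right[of a x] both[of a x] both[of x a] by (cases "a \<in> B"; simp)+
  qed (use \<open>carrier S - B \<noteq> {}\<close> in auto)
qed

section \<open>Equations in the Reilly semigroup\<close>

lemma inj_of_not_annihilating:
  assumes hom: "\<theta> \<in> hom integer_group integer_group" and "\<not> annihilating \<theta>"
  shows "inj \<theta>"
proof -
  have add: "\<theta> (x + y) = \<theta> x + \<theta> y" for x y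
    using hom by (simp add: hom_def)
  have zero: "\<theta> 0 = 0"
    using add[of 0 0] by simp
  define c where "c = \<theta> 1"
  have linear: "\<theta> z = z * c" for z
  proof (induction z rule: int_induct[where k = 0])
    case base
    show ?case using zero by simp
  next
    case (step1 z)
    then show ?case using add[of z 1] by (simp add: c_def algebra_simps)
  next
    case (step2 z)
    then show ?case using add[of "z - 1" 1] by (simp add: c_def algebra_simps)
  qed
  have "c \<noteq> 0"
    using \<open>\<not> annihilating \<theta>\<close> by (auto simp: annihilating_def linear)
  then show ?thesis
    by (auto simp: linear inj_def)
qed

text \<open>Write \<open>a = (i, s, j)\<close>, \<open>b = (p, q, r)\<close> and \<open>y = (m, t, n)\<close>. The first coordinate of \<open>a \<cdot> y = b\<close>
  bounds \<open>m\<close> by \<open>p + j\<close>. Once \<open>m\<close> is known, the third coordinate determines \<open>n\<close>, and the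
  second determines an iterate of \<open>\<theta>\<close> at \<open>t\<close>, hence \<open>t\<close> itself. The mirrored equation is governed by
  \<open>n\<close> in the same way.\<close>

lemma finite_reilly_left_quotient:
  assumes "inj \<theta>"
  shows "finite {y. reilly_mult \<theta> a y = b}"
proof -
  obtain i s j p q r where ab: "a = (i, s, j)" "b = (p, q, r)"
    by (metis prod_cases3)
  have "inj_on fst {y. reilly_mult \<theta> a y = b}"
  proof (rule inj_onI)
    fix y y'
    assume eqs: "y \<in> {y. reilly_mult \<theta> a y = b}" "y' \<in> {y. reilly_mult \<theta> a y = b}"
      and "fst y = fst y'"
    then obtain m t n t' n' where y: "y = (m, t, n)" "y' = (m, t', n')"
      by (metis fst_conv prod_cases3)
    have "(\<theta> ^^ (j - min j m)) t = (\<theta> ^^ (j - min j m)) t'"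
      and n: "j + n - min j m = j + n' - min j m"
      using eqs by (auto simp: reilly_mult_def ab y)
    then have "t = t'"
      using inj_fn[OF assms] by (simp add: inj_eq)
    moreover have "n = n'"
      using n by linarith
    ultimately show "y = y'"
      by (simp add: y)
  qed
  moreover have "fst ` {y. reilly_mult \<theta> a y = b} \<subseteq> {..p + j}"
    by (auto simp: reilly_mult_def ab min_def)
  ultimately show ?thesis
    using finite_atMost by (rule inj_on_finite)
qed

lemma finite_reilly_right_quotient:
  assumes "inj \<theta>"
  shows "finite {y. reilly_mult \<theta> y a = b}"
proof -
  obtain i s j p q r where ab: "a = (i, s, j)" "b = (p, q, r)"
    by (metis prod_cases3)
  have "inj_on (snd \<circ> snd) {y. reilly_mult \<theta> y a = b}"
  proof (rule inj_onI)
    fix y y'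
    assume eqs: "y \<in> {y. reilly_mult \<theta> y a = b}" "y' \<in> {y. reilly_mult \<theta> y a = b}"
      and "(snd \<circ> snd) y = (snd \<circ> snd) y'"
    then obtain m t n m' t' where y: "y = (m, t, n)" "y' = (m', t', n)"
      by (metis comp_apply snd_conv prod_cases3)
    have "(\<theta> ^^ (i - min n i)) t = (\<theta> ^^ (i - min n i)) t'"
      and m: "m + i - min n i = m' + i - min n i"
      using eqs by (auto simp: reilly_mult_def ab y)
    then have "t = t'"
      using inj_fn[OF assms] by (simp add: inj_eq)
    moreover have "m = m'"
      using m by linarith
    ultimately show "y = y'"
      by (simp add: y)
  qed
  moreover have "(snd \<circ> snd) ` {y. reilly_mult \<theta> y a = b} \<subseteq> {..r + i}"
    by (auto simp: reilly_mult_def ab min_def)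
  ultimately show ?thesis
    using finite_atMost by (rule inj_on_finite)
qed

section \<open>The remainder of the Reilly semigroup\<close>

theorem proposition5p1:
  fixes \<theta> :: "int \<Rightarrow> int"
    and S :: "('a, 'b) monoid_scheme"
    and T :: "'a topology"
    and \<iota> :: "nat \<times> int \<times> nat \<Rightarrow> 'a"
    and B I :: "'a set"
  assumes "\<theta> \<in> hom integer_group integer_group"
    and "\<not> annihilating \<theta>"
    and "semitopological_monoid S T"
    and "Hausdorff_space T"
    and "\<iota> \<in> mon (reilly \<theta>) S"
    and "B = \<iota> ` carrier (reilly \<theta>)"
    and "T closure_of B = topspace T"
    and "subtopology T B = discrete_topology B"
    and "I = carrier S - B"
    and "I \<noteq> {}"
  shows "two_sided_semigroup_ideal I S"
proof -
  interpret semitopological_monoid S T by fact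
  have "inj \<theta>"
    using assms(1,2) by (rule inj_of_not_annihilating)
  have hom: "\<iota> \<in> hom (reilly \<theta>) S" and "inj_on \<iota> (carrier (reilly \<theta>))"
    using \<open>\<iota> \<in> mon (reilly \<theta>) S\<close> by (auto simp: mon_def)
  then have inj: "inj \<iota>"
    by (simp add: reilly_def)
  have mult: "\<iota> (reilly_mult \<theta> x y) = \<iota> x \<otimes>\<^bsub>S\<^esub> \<iota> y" for x y
    using hom_mult[OF hom, of x y] by (simp add: reilly_def)
  have B: "B = range \<iota>"
    using assms(6) by (simp add: reilly_def)
  have "B \<subseteq> carrier S"
    using hom_carrier[OF hom] assms(6) by simp
  have left: "finite {y \<in> B. a \<otimes>\<^bsub>S\<^esub> y = b}" if "a \<in> B" "b \<in> B" for a b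
  proof -
    obtain u v where uv: "a = \<iota> u" "b = \<iota> v"
      using \<open>a \<in> B\<close> \<open>b \<in> B\<close> unfolding B by blast
    have "a \<otimes>\<^bsub>S\<^esub> \<iota> y = b \<longleftrightarrow> reilly_mult \<theta> u y = v" for y
      unfolding uv using inj by (metis mult inj_eq)
    then have "{y \<in> B. a \<otimes>\<^bsub>S\<^esub> y = b} = \<iota> ` {y. reilly_mult \<theta> u y = v}"
      unfolding B by blast
    then show ?thesis
      using finite_reilly_left_quotient[OF \<open>inj \<theta>\<close>] by simp
  qed
  have right: "finite {y \<in> B. y \<otimes>\<^bsub>S\<^esub> a = b}" if "a \<in> B" "b \<in> B" for a b
  proof -
    obtain u v where uv: "a = \<iota> u" "b = \<iota> v"
      using \<open>a \<in> B\<close> \<open>b \<in> B\<close> unfolding B by blast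
    have "\<iota> y \<otimes>\<^bsub>S\<^esub> a = b \<longleftrightarrow> reilly_mult \<theta> y u = v" for y
      unfolding uv using inj by (metis mult inj_eq)
    then have "{y \<in> B. y \<otimes>\<^bsub>S\<^esub> a = b} = \<iota> ` {y. reilly_mult \<theta> y u = v}"
      unfolding B by blast
    then show ?thesis
      using finite_reilly_right_quotient[OF \<open>inj \<theta>\<close>] by simp
  qed
  show ?thesis
    unfolding \<open>I = carrier S - B\<close>
  proof (rule ideal_of_finite_translation_fibres)
    show "t1_space T"
      using \<open>Hausdorff_space T\<close> by (rule Hausdorff_imp_t1_space)
    show "carrier S - B \<noteq> {}"
      using assms(9,10) by simp
  qed (fact assms(7,8) \<open>B \<subseteq> carrier S\<close> | simp add: left right)+
qed

end
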